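(* For any graphs $H$ and $F$ and for any $n$, we have $\mathrm{rb}(n,H,F)\le \mathrm{ex}^{\mathrm{col}}(n,H,K_2;F)$.
   Context: All graphs are finite and simple. A copy of $H$ in a graph $G$ is a (not necessarily induced) subgraph of $G$ isomorphic to $H$. $\mathcal{N}(H,G)$ denotes the number of copies of $H$ in $G$. A red-blue graph is a graph $G$ each of whose edges is colored red or blue; $G_{red}$ and $G_{blue}$ denote the subgraphs formed by the red edges and by the blue edges, respectively. $\mathcal{N}^{\mathrm{col}}(H_1,H_2;G)=\mathcal{N}(H_1,G_{red})+\mathcal{N}(H_2,G_{blue})$, and $\mathrm{ex}^{\mathrm{col}}(n,H_1,H_2;F)$ is the largest value of $\mathcal{N}^{\mathrm{col}}(H_1,H_2;G)$ over $n$-vertex red-blue graphs $G$ that are $F$-free, i.e. contain no copy of $F$ (regardless of colors). In particular $\mathcal{N}(K_2,G_{blue})$ is the number of blue edges. Given a graph $G$ and a family $\mathcal{H}$ of subgraphs of $G$, a subgraph $F$ of $G$ is called rainbow if there is an injection $\phi:E(F)\to\mathcal{H}$ such that each edge $e\in E(F)$ is an edge of $\phi(e)$. $\mathrm{rb}(n,H,F)$ denotes the largest cardinality of a family $\mathcal{H}$ of distinct copies of $H$ in an $n$-vertex graph $G$ such that no copy of $F$ in $G$ is rainbow (the maximum is over all $n$-vertex graphs $G$ and all such families). *)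

theory Defs
  imports Complex_Main
begin

section \<open>Finite simple graphs, subgraphs and copies\<close>

datatype 'a graph = Graph (verts: "'a set") (edges: "'a set set")

definition simple_graph :: "'a graph \<Rightarrow> bool" where
  "simple_graph G \<longleftrightarrow>
     finite (verts G) \<and> (\<forall>e\<in>edges G. e \<subseteq> verts G \<and> card e = 2)"

definition subgraph :: "'a graph \<Rightarrow> 'a graph \<Rightarrow> bool" where
  "subgraph S G \<longleftrightarrow>
     simple_graph S \<and> verts S \<subseteq> verts G \<and> edges S \<subseteq> edges G"

definition graph_iso :: "'a graph \<Rightarrow> 'b graph \<Rightarrow> bool" where
  "graph_iso H S \<longleftrightarrow>
     (\<exists>f. bij_betw f (verts H) (verts S) \<and> edges S = (\<lambda>e. f ` e) ` edges H)"

text \<open>A copy is a subgraph, i.e. a vertex set together with an edge set. If \<open>H\<close> has isolated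
  vertices, two copies with the same edges but different vertex sets are therefore distinct.\<close>

definition copies :: "'a graph \<Rightarrow> 'b graph \<Rightarrow> 'b graph set" where
  "copies H G = {S. subgraph S G \<and> graph_iso H S}"

definition num_copies :: "'a graph \<Rightarrow> 'b graph \<Rightarrow> nat" where
  "num_copies H G = card (copies H G)"

definition free_of :: "'a graph \<Rightarrow> 'b graph \<Rightarrow> bool" where
  "free_of F G \<longleftrightarrow> copies F G = {}"

definition complete_graph :: "nat \<Rightarrow> nat graph" where
  "complete_graph r = Graph {..<r} {e. e \<subseteq> {..<r} \<and> card e = 2}"


section \<open>Red-blue graphs\<close>

datatype colour = Red | Blue

text \<open>A red-blue graph is a graph \<open>G\<close> with a colouring \<open>c\<close>, of which only the values on
  \<open>edges G\<close> matter. The red and the blue subgraph are spanning: they keep all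
  vertices of \<open>G\<close>, which makes a difference when counting copies of graphs with isolated
  vertices.\<close>

definition colour_part :: "colour \<Rightarrow> 'a graph \<Rightarrow> ('a set \<Rightarrow> colour) \<Rightarrow> 'a graph" where
  "colour_part k G c = Graph (verts G) {e \<in> edges G. c e = k}"

definition num_col :: "'a graph \<Rightarrow> 'b graph \<Rightarrow> 'c graph \<Rightarrow> ('c set \<Rightarrow> colour) \<Rightarrow> nat" where
  "num_col H1 H2 G c =
     num_copies H1 (colour_part Red G c) + num_copies H2 (colour_part Blue G c)"

text \<open>Every finite graph is isomorphic to one with vertices in \<open>nat\<close>, so the maxima over all
  \<open>n\<close>-vertex graphs are taken over graphs with \<open>n\<close> natural numbers as vertices. For fixed
  \<open>n\<close> the values are bounded, so \<open>Sup\<close> is a maximum whenever some graph is admissible;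
  \<open>Sup {} = 0\<close> on \<open>nat\<close>, which concerns only edgeless \<open>F\<close> with at most \<open>n\<close> vertices.\<close>

definition ex_col :: "nat \<Rightarrow> 'a graph \<Rightarrow> 'b graph \<Rightarrow> 'c graph \<Rightarrow> nat" where
  "ex_col n H1 H2 F =
     Sup {num_col H1 H2 G c | (G :: nat graph) c.
            simple_graph G \<and> card (verts G) = n \<and> free_of F G}"


section \<open>Rainbow subgraphs\<close>

definition rainbow :: "'a graph set \<Rightarrow> 'a graph \<Rightarrow> bool" where
  "rainbow \<H> S \<longleftrightarrow>
     (\<exists>\<phi>. inj_on \<phi> (edges S) \<and> \<phi> ` edges S \<subseteq> \<H> \<and> (\<forall>e\<in>edges S. e \<in> edges (\<phi> e)))"

definition rb :: "nat \<Rightarrow> 'a graph \<Rightarrow> 'b graph \<Rightarrow> nat" where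
  "rb n H F =
     Sup {card \<H> | (G :: nat graph) \<H>.
            simple_graph G \<and> card (verts G) = n \<and> \<H> \<subseteq> copies H G \<and>
            (\<forall>S\<in>copies F G. \<not> rainbow \<H> S)}"

end

theory Submission
  imports Defs
begin

text \<open>Consider the bipartite incidence structure between the edges of \<open>G\<close> and the family
  \<open>\<H>\<close>, and let \<open>P \<subseteq> \<H>\<close> minimise \<open>|E(P)| + |\<H> - P|\<close>, where \<open>E(P)\<close> is the set of edges
  covered by \<open>P\<close>. By Hall's theorem and minimality, the edges in \<open>E(P)\<close> can be assigned
  injectively to members of \<open>P\<close>, and every member of \<open>\<H> - P\<close> can be assigned a private edge
  outside \<open>E(P)\<close>. Colour \<open>E(P)\<close> red and the private edges blue. Every subgraph of the
  resulting graph is rainbow, so the graph is \<open>F\<close>-free; the members of \<open>P\<close> are red copies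
  of \<open>H\<close> and there are \<open>|\<H> - P|\<close> blue edges.\<close>

text \<open>Halmos-Vaughan induction. If a nonempty proper \<open>J\<close> is tight, match
  \<open>J\<close> and \<open>I - J\<close> separately; otherwise every nonempty proper subset has a
  surplus neighbour, so one index may take any of its neighbours.\<close>

theorem hall_marriage:
  fixes N :: "'i \<Rightarrow> 'e set"
  assumes "finite I" and "\<And>i. i \<in> I \<Longrightarrow> finite (N i)"
    and "\<And>J. J \<subseteq> I \<Longrightarrow> card J \<le> card (\<Union>(N ` J))"
  shows "\<exists>m. inj_on m I \<and> (\<forall>i\<in>I. m i \<in> N i)"
  using assms
proof (induction I arbitrary: N rule: finite_psubset_induct)
  case (psubset I)
  note fin = psubset.prems(1) and hall = psubset.prems(2)
  show ?case
  proof (cases "\<exists>J. J \<subset> I \<and> J \<noteq> {} \<and> card (\<Union>(N ` J)) = card J")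
    case True
    then obtain J where J: "J \<subset> I" "J \<noteq> {}" and tight: "card (\<Union>(N ` J)) = card J"
      by blast
    have finJ: "finite J" using J psubset.hyps finite_subset by blast
    have finN: "finite (\<Union>(N ` K))" if "K \<subseteq> I" for K
      using that fin psubset.hyps by (meson finite_UN_I finite_subset subsetD)
    have "\<exists>m. inj_on m J \<and> (\<forall>i\<in>J. m i \<in> N i)"
      using psubset.IH[of J N] J fin hall by (metis psubset_imp_subset subset_iff subset_trans)
    then obtain m1 where m1: "inj_on m1 J" "\<forall>i\<in>J. m1 i \<in> N i" by blast
    \<comment> \<open>Removing all neighbours of \<open>J\<close> preserves Hall's condition:
      \<open>J \<union> K\<close> has at least \<open>card J + card K\<close> neighbours, and
      tightness says that only \<open>card J\<close> of them are removed.\<close>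
    define N' where "N' i = N i - \<Union>(N ` J)" for i
    have "\<exists>m. inj_on m (I - J) \<and> (\<forall>i\<in>I - J. m i \<in> N' i)"
    proof (rule psubset.IH)
      show "I - J \<subset> I" using J by blast
      show "finite (N' i)" if "i \<in> I - J" for i using that fin by (simp add: N'_def)
      fix K assume K: "K \<subseteq> I - J"
      have finK: "finite K" using K psubset.hyps finite_subset by blast
      have "card J + card K = card (J \<union> K)"
        using K finJ finK by (subst card_Un_disjoint) auto
      also have "\<dots> \<le> card (\<Union>(N ` (J \<union> K)))" using K J by (intro hall) auto
      also have "\<Union>(N ` (J \<union> K)) = \<Union>(N ` J) \<union> \<Union>(N' ` K)" by (auto simp: N'_def)
      also have "card \<dots> \<le> card J + card (\<Union>(N' ` K))" using card_Un_le tight by metis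
      finally show "card K \<le> card (\<Union>(N' ` K))" by simp
    qed
    then obtain m2 where m2: "inj_on m2 (I - J)" "\<forall>i\<in>I - J. m2 i \<in> N' i" by blast
    define m where "m i = (if i \<in> J then m1 i else m2 i)" for i
    have disj: "m1 i \<noteq> m2 j" if "i \<in> J" "j \<in> I - J" for i j
      using that m1(2) m2(2) unfolding N'_def by (metis DiffE UN_I)
    have "inj_on m I"
      using m1(1) m2(1) disj unfolding inj_on_def m_def by (metis DiffI)
    moreover have "\<forall>i\<in>I. m i \<in> N i" using m1(2) m2(2) by (auto simp: m_def N'_def)
    ultimately show ?thesis by blast
  next
    case slack: False
    show ?thesis
    proof (cases "I = {}")
      case False
      then obtain i where i: "i \<in> I" by blast
      have "card {i} \<le> card (N i)" using hall[of "{i}"] i by simp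
      then obtain x where x: "x \<in> N i" by fastforce
      have "\<exists>m. inj_on m (I - {i}) \<and> (\<forall>j\<in>I - {i}. m j \<in> N j - {x})"
      proof (rule psubset.IH)
        show "I - {i} \<subset> I" using i by blast
        show "finite (N j - {x})" if "j \<in> I - {i}" for j using that fin by simp
        fix K assume K: "K \<subseteq> I - {i}"
        show "card K \<le> card (\<Union>j\<in>K. N j - {x})"
        proof (cases "K = {}")
          case False
          \<comment> \<open>\<open>K\<close> misses \<open>i\<close>, so it is a proper subset and
            not tight; its surplus of at least one pays for the loss of \<open>x\<close>.\<close>
          have "card (\<Union>(N ` K)) \<noteq> card K" using slack False K i by blast
          moreover have "card K \<le> card (\<Union>(N ` K))" using K by (intro hall) auto
          moreover have "(\<Union>j\<in>K. N j - {x}) = \<Union>(N ` K) - {x}" by auto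
          moreover have "card (\<Union>(N ` K)) - 1 \<le> card (\<Union>(N ` K) - {x})"
            by (simp add: card_Diff_singleton_if)
          ultimately show ?thesis by simp
        qed simp
      qed
      then obtain m where m: "inj_on m (I - {i})" "\<forall>j\<in>I - {i}. m j \<in> N j - {x}" by blast
      have "inj_on (m(i := x)) (insert i (I - {i}))"
        using m by (auto simp: inj_on_def)
      then have "inj_on (m(i := x)) I" using i by (simp add: insert_absorb)
      moreover have "\<forall>j\<in>I. (m(i := x)) j \<in> N j" using m x by auto
      ultimately show ?thesis by blast
    qed simp
  qed
qed

lemma minimum_cover_matchings:
  fixes N :: "'i \<Rightarrow> 'e set"
  assumes fin: "finite I" and finN: "\<And>i. i \<in> I \<Longrightarrow> finite (N i)"
  obtains P \<phi> m where "P \<subseteq> I"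
    and "inj_on \<phi> (\<Union>(N ` P))" and "\<forall>e\<in>\<Union>(N ` P). \<phi> e \<in> P \<and> e \<in> N (\<phi> e)"
    and "inj_on m (I - P)" and "\<forall>i\<in>I - P. m i \<in> N i - \<Union>(N ` P)"
proof -
  define cost where "cost P = card (\<Union>(N ` P)) + card (I - P)" for P
  have "\<exists>P. is_arg_min cost (\<lambda>P. P \<in> Pow I) P"
    using ex_is_arg_min_if_finite[of "Pow I" cost] fin by auto
  then obtain P where P: "P \<subseteq> I" and min: "\<And>K. K \<subseteq> I \<Longrightarrow> cost P \<le> cost K"
    by (auto simp: is_arg_min_linorder)
  have finU: "finite (\<Union>(N ` K))" if "K \<subseteq> I" for K
    using that fin finN by (meson finite_UN_I finite_subset subsetD)
  have finP: "finite P" using P fin finite_subset by blast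
  have "\<exists>\<phi>. inj_on \<phi> (\<Union>(N ` P)) \<and> (\<forall>e\<in>\<Union>(N ` P). \<phi> e \<in> {i \<in> P. e \<in> N i})"
  proof (rule hall_marriage)
    show "finite (\<Union>(N ` P))" using finU P .
    show "finite {i \<in> P. e \<in> N i}" for e using finP by simp
    fix X assume X: "X \<subseteq> \<Union>(N ` P)"
    \<comment> \<open>\<open>T\<close> is the neighbourhood of \<open>X\<close> in \<open>P\<close>.
      Dropping \<open>T\<close> uncovers all of \<open>X\<close> and adds at most
      \<open>card T\<close> uncovered indices, so minimality forces
      \<open>card X \<le> card T\<close>.\<close>
    define T where "T = (\<Union>e\<in>X. {i \<in> P. e \<in> N i})"
    have T: "T \<subseteq> P" by (auto simp: T_def)
    have "card (\<Union>(N ` (P - T))) \<le> card (\<Union>(N ` P) - X)"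
      using finU[OF P] by (intro card_mono) (auto simp: T_def)
    also have "\<dots> = card (\<Union>(N ` P)) - card X"
      using X finU[OF P] by (meson card_Diff_subset finite_subset)
    finally have "card (\<Union>(N ` (P - T))) + card X \<le> card (\<Union>(N ` P))"
      using card_mono[OF finU[OF P] X] by linarith
    moreover have "card (I - (P - T)) \<le> card (I - P) + card T"
    proof -
      have "I - (P - T) \<subseteq> (I - P) \<union> T" by blast
      then show ?thesis
        using fin T finP by (meson card_Un_le card_mono finite_Diff finite_UnI finite_subset le_trans)
    qed
    moreover have "cost P \<le> cost (P - T)" using P by (intro min) auto
    ultimately show "card X \<le> card (\<Union>e\<in>X. {i \<in> P. e \<in> N i})"
      unfolding cost_def T_def[symmetric] by linarith
  qed
  then obtain \<phi> where \<phi>: "inj_on \<phi> (\<Union>(N ` P))"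
    "\<forall>e\<in>\<Union>(N ` P). \<phi> e \<in> P \<and> e \<in> N (\<phi> e)" by auto
  have "\<exists>m. inj_on m (I - P) \<and> (\<forall>i\<in>I - P. m i \<in> N i - \<Union>(N ` P))"
  proof (rule hall_marriage)
    show "finite (I - P)" using fin by simp
    show "finite (N i - \<Union>(N ` P))" if "i \<in> I - P" for i using that finN by simp
    fix T assume T: "T \<subseteq> I - P"
    \<comment> \<open>Moving \<open>T\<close> into \<open>P\<close> saves \<open>card T\<close> and
      costs at most the number of newly covered elements, so minimality bounds \<open>card T\<close>
      by that number.\<close>
    have "\<Union>(N ` (P \<union> T)) = \<Union>(N ` P) \<union> (\<Union>i\<in>T. N i - \<Union>(N ` P))" by auto
    then have "card (\<Union>(N ` (P \<union> T))) \<le> card (\<Union>(N ` P)) + card (\<Union>i\<in>T. N i - \<Union>(N ` P))"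
      by (metis card_Un_le)
    moreover have "card (I - (P \<union> T)) + card T = card (I - P)"
    proof -
      have "I - (P \<union> T) = (I - P) - T" by blast
      then show ?thesis
        using T fin by (metis card_Diff_subset card_mono finite_Diff finite_subset le_add_diff_inverse2)
    qed
    moreover have "cost P \<le> cost (P \<union> T)" using P T by (intro min) auto
    ultimately show "card T \<le> card (\<Union>i\<in>T. N i - \<Union>(N ` P))"
      unfolding cost_def by linarith
  qed
  then obtain m where m: "inj_on m (I - P)" "\<forall>i\<in>I - P. m i \<in> N i - \<Union>(N ` P)"
    by blast
  show thesis by (rule that[OF P \<phi> m])
qed

text \<open>A copy is a vertex set paired with a set of subsets of \<open>verts G\<close>. The crude
  bound matters only because it depends on the number of vertices alone.\<close>

lemma copies_bound:
  assumes "finite (verts G)"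
  shows "finite (copies H G)"
    and "num_copies H G \<le> 2 ^ card (verts G) * 2 ^ (2 ^ card (verts G))"
proof -
  let ?A = "(\<lambda>(V, E). Graph V E) ` (Pow (verts G) \<times> Pow (Pow (verts G)))"
  have "copies H G \<subseteq> ?A"
  proof
    fix S assume "S \<in> copies H G"
    then have "subgraph S G" by (simp add: copies_def)
    then have "verts S \<subseteq> verts G" "edges S \<subseteq> Pow (verts G)"
      by (auto simp: subgraph_def simple_graph_def)
    then show "S \<in> ?A" by (cases S) auto
  qed
  moreover have fin: "finite (Pow (verts G) \<times> Pow (Pow (verts G)))" using assms by simp
  ultimately show "finite (copies H G)"
    by (meson finite_imageI finite_subset)
  have "num_copies H G \<le> card ?A"
    unfolding num_copies_def using \<open>copies H G \<subseteq> ?A\<close> fin by (meson card_mono finite_imageI)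
  also have "\<dots> \<le> card (Pow (verts G) \<times> Pow (Pow (verts G)))"
    using fin by (rule card_image_le)
  also have "\<dots> = 2 ^ card (verts G) * 2 ^ (2 ^ card (verts G))"
    using assms by (simp add: card_cartesian_product card_Pow)
  finally show "num_copies H G \<le> 2 ^ card (verts G) * 2 ^ (2 ^ card (verts G))" .
qed

text \<open>Distinct edges \<open>e\<close> give distinct copies \<open>Graph e {e}\<close>. This
  turns private blue edges into a contribution to \<open>num_col\<close>.\<close>

lemma card_edges_le_num_copies_K2:
  assumes "simple_graph G"
  shows "card (edges G) \<le> num_copies (complete_graph 2) G"
proof -
  have "Graph e {e} \<in> copies (complete_graph 2) G" if e: "e \<in> edges G" for e
  proof -
    have sub: "e \<subseteq> verts G" and card: "card e = 2"
      using assms e by (auto simp: simple_graph_def)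
    have fin: "finite e" using card card.infinite by fastforce
    have "subgraph (Graph e {e}) G"
      using sub card fin e by (simp add: subgraph_def simple_graph_def)
    moreover obtain f where f: "bij_betw f {..<2::nat} e"
      using fin card by (metis card_lessThan finite_lessThan finite_same_card_bij)
    \<comment> \<open>The only edge of \<open>complete_graph 2\<close> is its whole vertex set,
      which \<open>f\<close> maps onto \<open>e\<close>.\<close>
    have "{x. x \<subseteq> {..<2::nat} \<and> card x = 2} = {{..<2}}"
      using card_subset_eq[of "{..<2::nat}"] by auto
    then have "graph_iso (complete_graph 2) (Graph e {e})"
      using f unfolding graph_iso_def complete_graph_def
      by (auto simp: bij_betw_def)
    ultimately show ?thesis by (simp add: copies_def)
  qed
  then have "(\<lambda>e. Graph e {e}) ` edges G \<subseteq> copies (complete_graph 2) G" by blast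
  moreover have "finite (copies (complete_graph 2) G)"
    using assms copies_bound(1) by (auto simp: simple_graph_def)
  moreover have "inj_on (\<lambda>e. Graph e {e}) (edges G)" by (auto intro: inj_onI)
  ultimately show ?thesis unfolding num_copies_def by (metis card_image card_mono)
qed

text \<open>On \<open>nat\<close>, \<open>Sup\<close> is known to dominate the members of a set only
  if the set is bounded above; this licenses \<open>cSup_upper\<close> for
  \<open>ex_col\<close>.\<close>

lemma bdd_above_num_col:
  "bdd_above {num_col H1 H2 G c | (G :: nat graph) c.
     simple_graph G \<and> card (verts G) = n \<and> free_of F G}"
proof (rule bdd_aboveI)
  fix x
  assume "x \<in> {num_col H1 H2 G c | (G :: nat graph) c.
     simple_graph G \<and> card (verts G) = n \<and> free_of F G}"
  then obtain G :: "nat graph" and c where x: "x = num_col H1 H2 G c"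
    and G: "finite (verts G)" "card (verts G) = n"
    by (auto simp: simple_graph_def)
  have "verts (colour_part k G c) = verts G" for k by (simp add: colour_part_def)
  then show "x \<le> 2 ^ n * 2 ^ (2 ^ n) + 2 ^ n * 2 ^ (2 ^ n)"
    using G copies_bound(2)[of "colour_part Red G c" H1]
      copies_bound(2)[of "colour_part Blue G c" H2]
    unfolding x num_col_def by simp
qed

lemma coloured_graph_of_rainbow_free_family:
  assumes G: "simple_graph G" and fam: "\<H> \<subseteq> copies H G"
    and norb: "\<forall>S\<in>copies F G. \<not> rainbow \<H> S"
  obtains G' c where "simple_graph G'" "verts G' = verts G" "free_of F G'"
    "card \<H> \<le> num_col H (complete_graph 2) G' c"
proof -
  have finV: "finite (verts G)" using G by (simp add: simple_graph_def)
  have "edges G \<subseteq> Pow (verts G)" using G by (auto simp: simple_graph_def)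
  then have finE: "finite (edges G)" using finV finite_subset by blast
  have fin: "finite \<H>" using fam copies_bound(1)[OF finV] finite_subset by blast
  have sub: "subgraph S G" if "S \<in> \<H>" for S using that fam by (auto simp: copies_def)
  have finS: "finite (edges S)" if "S \<in> \<H>" for S
    using sub[OF that] finE finite_subset by (auto simp: subgraph_def)
  obtain P \<phi> m where P: "P \<subseteq> \<H>" and \<phi>: "inj_on \<phi> (\<Union>(edges ` P))"
      "\<forall>e\<in>\<Union>(edges ` P). \<phi> e \<in> P \<and> e \<in> edges (\<phi> e)"
    and m: "inj_on m (\<H> - P)" "\<forall>S\<in>\<H> - P. m S \<in> edges S - \<Union>(edges ` P)"
    using minimum_cover_matchings[OF fin finS] .
  define R where "R = \<Union>(edges ` P)"
  define B where "B = m ` (\<H> - P)"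
  \<comment> \<open>All vertices stay, so the order is still \<open>n\<close> and isolated vertices
    of copies survive. Edges outside \<open>R \<union> B\<close> are dropped, since they have no
    assigned member of \<open>\<H>\<close>.\<close>
  define G' where "G' = Graph (verts G) (R \<union> B)"
  define c where "c e = (if e \<in> R then Red else Blue)" for e
  have disj: "R \<inter> B = {}" using m(2) by (auto simp: R_def B_def)
  have RB: "R \<union> B \<subseteq> edges G"
    using P m(2) sub by (fastforce simp: R_def B_def subgraph_def)
  have simp: "simple_graph (Graph (verts G) X)" if "X \<subseteq> edges G" for X
    using G that by (auto simp: simple_graph_def)
  have red: "colour_part Red G' c = Graph (verts G) R"
    by (auto simp: colour_part_def G'_def c_def)
  have blue: "colour_part Blue G' c = Graph (verts G) B"
    using disj by (auto simp: colour_part_def G'_def c_def)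
  \<comment> \<open>Gluing \<open>\<phi>\<close> with the inverse of \<open>m\<close> gives one
    injection of all edges of \<open>G'\<close> into \<open>\<H>\<close>; restricted to any
    subgraph, it witnesses \<open>rainbow\<close>.\<close>
  define \<psi> where "\<psi> e = (if e \<in> R then \<phi> e else inv_into (\<H> - P) m e)" for e
  have \<psi>R: "\<psi> e \<in> P \<and> e \<in> edges (\<psi> e)" if "e \<in> R" for e
    using \<phi>(2) that by (auto simp: \<psi>_def R_def)
  have \<psi>B: "\<psi> e \<in> \<H> - P \<and> e \<in> edges (\<psi> e)" if "e \<in> B" for e
  proof -
    have "\<psi> e = inv_into (\<H> - P) m e" using that disj by (auto simp: \<psi>_def)
    moreover have "inv_into (\<H> - P) m e \<in> \<H> - P" "m (inv_into (\<H> - P) m e) = e"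
      using that inv_into_into f_inv_into_f unfolding B_def by metis+
    ultimately show ?thesis using m(2) by (metis DiffD1)
  qed
  have inj: "inj_on \<psi> (R \<union> B)"
  proof (rule inj_onI)
    fix x y assume xy: "x \<in> R \<union> B" "y \<in> R \<union> B" and eq: "\<psi> x = \<psi> y"
    \<comment> \<open>Red edges go to \<open>P\<close> and blue ones to \<open>\<H> - P\<close>, so
      edges of different colours cannot collide.\<close>
    from xy eq \<psi>R[of x] \<psi>R[of y] \<psi>B[of x] \<psi>B[of y]
    consider "x \<in> R" "y \<in> R" | "x \<in> B" "y \<in> B" by auto
    then show "x = y"
    proof cases
      case 1
      then show ?thesis using eq \<phi>(1) by (auto simp: \<psi>_def R_def[symmetric] dest: inj_onD)
    next
      case 2
      then have "x \<notin> R" "y \<notin> R" using disj by auto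
      then have "inv_into (\<H> - P) m x = inv_into (\<H> - P) m y" using eq by (simp add: \<psi>_def)
      then show ?thesis using 2 inv_into_injective unfolding B_def by metis
    qed
  qed
  have "free_of F G'"
  proof -
    have False if S: "S \<in> copies F G'" for S
    proof -
      have eS: "edges S \<subseteq> R \<union> B" using S by (simp add: copies_def subgraph_def G'_def)
      have "S \<in> copies F G" using S RB by (auto simp: copies_def subgraph_def G'_def)
      moreover have "rainbow \<H> S" unfolding rainbow_def
        using inj_on_subset[OF inj eS] eS \<psi>R \<psi>B P by (intro exI[of _ \<psi>]) blast
      ultimately show False using norb by blast
    qed
    then show ?thesis by (auto simp: free_of_def)
  qed
  moreover have "card \<H> \<le> num_col H (complete_graph 2) G' c"
  proof -
    \<comment> \<open>\<open>R\<close> contains every edge of every member of \<open>P\<close>, so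
      these copies lie entirely in the red graph.\<close>
    have "P \<subseteq> copies H (Graph (verts G) R)"
      using P fam by (auto simp: copies_def subgraph_def R_def)
    then have "card P \<le> num_copies H (colour_part Red G' c)"
      unfolding red num_copies_def using finV by (intro card_mono copies_bound(1)) auto
    moreover have "card (\<H> - P) = card B" unfolding B_def using m(1) by (simp add: card_image)
    moreover have "card B \<le> num_copies (complete_graph 2) (colour_part Blue G' c)"
      using card_edges_le_num_copies_K2[OF simp[of B]] RB by (simp add: blue)
    moreover have "card \<H> = card P + card (\<H> - P)"
      using P fin by (metis card_Diff_subset card_mono finite_subset le_add_diff_inverse)
    ultimately show ?thesis unfolding num_col_def by linarith
  qed
  ultimately show thesis using that[of G' c] simp[OF RB] by (simp add: G'_def)
qed

theorem lemma2p4: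
  fixes H :: "'a graph" and F :: "'b graph" and n :: nat
  assumes "simple_graph H" and "simple_graph F"
  shows "rb n H F \<le> ex_col n H (complete_graph 2) F"
proof -
  define A where "A = {card \<H> | (G :: nat graph) \<H>.
            simple_graph G \<and> card (verts G) = n \<and> \<H> \<subseteq> copies H G \<and>
            (\<forall>S\<in>copies F G. \<not> rainbow \<H> S)}"
  have "x \<le> ex_col n H (complete_graph 2) F" if x_in: "x \<in> A" for x
  proof -
    obtain G :: "nat graph" and \<H> where x: "x = card \<H>" and n: "card (verts G) = n"
      and G: "simple_graph G" "\<H> \<subseteq> copies H G" "\<forall>S\<in>copies F G. \<not> rainbow \<H> S"
      using x_in unfolding A_def by blast
    obtain G' c where G': "simple_graph G'" "verts G' = verts G" "free_of F G'"
      and le: "card \<H> \<le> num_col H (complete_graph 2) G' c"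
      using coloured_graph_of_rainbow_free_family[OF G] .
    have "num_col H (complete_graph 2) G' c \<le> ex_col n H (complete_graph 2) F"
      unfolding ex_col_def using G' n by (intro cSup_upper bdd_above_num_col) auto
    with le x show ?thesis by simp
  qed
  \<comment> \<open>\<open>cSup_least\<close> requires a nonempty set; for empty \<open>A\<close>
    the supremum on \<open>nat\<close> is 0 by convention.\<close>
  then have "Sup A \<le> ex_col n H (complete_graph 2) F"
    by (cases "A = {}") (simp add: Sup_nat_def, blast intro: cSup_least)
  then show ?thesis by (simp add: rb_def A_def)
qed

end
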